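(* Let $X,Y,Z,V,W$ be non-void sets, let $\mathcal{H}$ be a set of mappings from $X$ to $Y$, and let $R\colon Z\times W\to[0,\infty)$ and $S\colon\mathcal{H}\times Z\times V\to[0,\infty)$ be arbitrary mappings. Let $p_1,p_2,q_1,q_2$ be real numbers such that $p_j\le q_j$ for $j=1,2$, $1\le p_1\le p_2<\infty$, $1\le q_1\le q_2<\infty$ and $$\frac1{p_1}-\frac1{q_1}\le\frac1{p_2}-\frac1{q_2}.$$ Suppose that for $i=1,2$, every $f\in\mathcal{H}$, every positive integer $m$ and all $z_1,\dots,z_m\in Z$, $$\sup_{w\in W}\sum_{j=1}^m R(z_j,w)^{p_i}<\infty\quad\text{and}\quad \sup_{v\in V}\sum_{j=1}^m S(f,z_j,v)^{q_i}<\infty .$$ If $p_1<p_2$ and $$\alpha=\frac{q_2p_1}{q_1p_2},$$ then $$RS_{((q_1,1),p_1)}\subset RS_{((q_2,\alpha),p_2)}.$$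
   Context: For $1\le p\le q<\infty$ and a real number $\alpha$ (here nonzero), a mapping $f\in\mathcal{H}$ is called $RS$-abstract $((q,\alpha),p)$-summing, written $f\in RS_{((q,\alpha),p)}$, if there is a constant $C>0$ such that $$\left(\sup_{v\in V}\sum_{j=1}^m S(f,z_j,v)^q\right)^{1/\alpha}\le C\sup_{w\in W}\sum_{j=1}^m R(z_j,w)^p$$ for every positive integer $m$ and all $z_1,\dots,z_m\in Z$. *)

theory Defs
  imports Complex_Main "HOL-Library.FuncSet"
begin

text \<open>
  The suprema are taken in \<^typ>\<open>real\<close>, so they have their usual meaning when the sums are
  bounded over \<^term>\<open>V\<close> and \<^term>\<open>W\<close>; this is the finiteness predicate below.
  Real powers are written with \<open>powr\<close>, where \<open>0 powr a = 0\<close>; this agrees with the usual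
  convention for the positive exponents \<open>p\<close>, \<open>q\<close> and, when \<open>\<alpha> > 0\<close>, for \<open>1 / \<alpha>\<close>.
\<close>

definition finite_sup_sums :: "'z set \<Rightarrow> 'i set \<Rightarrow> ('z \<Rightarrow> 'i \<Rightarrow> real) \<Rightarrow> real \<Rightarrow> bool" where
  "finite_sup_sums Z I T r \<longleftrightarrow>
     (\<forall>m\<ge>1. \<forall>z \<in> {1..m::nat} \<rightarrow> Z. bdd_above ((\<lambda>i. \<Sum>j=1..m. T (z j) i powr r) ` I))"

definition RS_summing ::
  "('x \<Rightarrow> 'y) set \<Rightarrow> 'z set \<Rightarrow> 'v set \<Rightarrow> 'w set \<Rightarrow> ('z \<Rightarrow> 'w \<Rightarrow> real) \<Rightarrow>
   (('x \<Rightarrow> 'y) \<Rightarrow> 'z \<Rightarrow> 'v \<Rightarrow> real) \<Rightarrow> real \<Rightarrow> real \<Rightarrow> real \<Rightarrow> ('x \<Rightarrow> 'y) set" where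
  "RS_summing H Z V W R S q \<alpha> p =
     {f \<in> H. \<exists>C>0. \<forall>m\<ge>1. \<forall>z \<in> {1..m::nat} \<rightarrow> Z.
        (SUP v\<in>V. \<Sum>j=1..m. S f (z j) v powr q) powr (1 / \<alpha>)
          \<le> C * (SUP w\<in>W. \<Sum>j=1..m. R (z j) w powr p)}"

end

theory Submission
  imports Defs "HOL-Analysis.Convex"
begin

text \<open>
  The summing inequality with exponents \<open>q1\<close>, \<open>p1\<close> is stable under repetition of points. Since
  both of its sides are homogeneous in the multiplicities, approximating real weights by rational ones
  gives, for all \<open>\<lambda>\<^sub>j \<ge> 0\<close> and every \<open>v\<close>,
  \[\sum_j \lambda_j S(f,z_j,v)^{q_1} \le C \sup_w \sum_j \lambda_j R(z_j,w)^{p_1}\]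
  (lemma \<open>weights_from_repetition\<close>). This takes the place of scaling the points \<open>z\<^sub>j\<close>, for which the
  bare set \<open>Z\<close> has no structure.

  Fix \<open>v\<close>, write \<open>S\<^sub>j\<close> for \<open>S(f,z\<^sub>j,v)\<close>, and choose \<open>\<lambda>\<^sub>j = S\<^sub>j powr (q2 - q1)\<close>, which turns the
  left-hand side into \<open>T = (\<Sum>j. S\<^sub>j powr q2)\<close>. The hypothesis on the reciprocals and
  \<open>p1 \<le> q1\<close> give \<open>q1 / q2 \<le> p1 / p2\<close> (lemma \<open>exponent_ratio_le\<close>). Hence the exponents \<open>(q2 - q1) / q2\<close> and \<open>p1 / p2\<close>
  add up to at least 1, and the Hoelder inequality (lemma \<open>Hoelder_sum_powr\<close>) bounds the
  right-hand side by \<open>C * T powr ((q2 - q1) / q2) * M powr (p1 / p2)\<close>, where \<open>M\<close> is the supremum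
  over \<open>w\<close> of the sums of \<open>R(z\<^sub>j,w) powr p2\<close>. Dividing by the power of \<open>T\<close> leaves
  \<open>T powr (q1 / q2) \<le> C * M powr (p1 / p2)\<close>, and the power \<open>p2 / p1\<close> of this is the claim, with
  constant \<open>C powr (p2 / p1)\<close>.
\<close>

text \<open>
  Beyond the conjugate case \<open>s + t = 1\<close>, exponents with a larger sum are covered because after
  normalising both sums to 1 all terms lie in \<open>[0, 1]\<close>, where raising an exponent decreases a power.
\<close>

lemma Hoelder_sum_powr:
  fixes a b :: "'i \<Rightarrow> real" and s t :: real
  assumes "finite I" and a: "\<And>i. i \<in> I \<Longrightarrow> 0 \<le> a i" and b: "\<And>i. i \<in> I \<Longrightarrow> 0 \<le> b i"
    and s: "0 < s" and t: "0 < t" and st: "1 \<le> s + t"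
  shows "(\<Sum>i\<in>I. a i powr s * b i powr t) \<le> (\<Sum>i\<in>I. a i) powr s * (\<Sum>i\<in>I. b i) powr t"
proof -
  define A B where "A = (\<Sum>i\<in>I. a i)" and "B = (\<Sum>i\<in>I. b i)"
  have "0 \<le> A" "0 \<le> B"
    unfolding A_def B_def using a b by (auto intro: sum_nonneg)
  consider "A = 0" | "B = 0" | "0 < A" "0 < B"
    using \<open>0 \<le> A\<close> \<open>0 \<le> B\<close> by linarith
  then have "(\<Sum>i\<in>I. a i powr s * b i powr t) \<le> A powr s * B powr t"
  proof cases
    case 1
    then have "\<forall>i\<in>I. a i = 0"
      using assms(1) a by (simp add: A_def sum_nonneg_eq_0_iff)
    then show ?thesis by simp
  next
    case 2
    then have "\<forall>i\<in>I. b i = 0"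
      using assms(1) b by (simp add: B_def sum_nonneg_eq_0_iff)
    then show ?thesis by simp
  next
    case 3
    define \<sigma> \<tau> where "\<sigma> = s / (s + t)" and "\<tau> = t / (s + t)"
    have \<sigma>\<tau>: "0 < \<sigma>" "0 < \<tau>" "\<sigma> + \<tau> = 1" "s = \<sigma> * (s + t)" "t = \<tau> * (s + t)"
      using s t by (auto simp: \<sigma>_def \<tau>_def simp flip: add_divide_distrib)
    have le1: "x powr s * y powr t \<le> \<sigma> * x + \<tau> * y"
      if "0 \<le> x" "x \<le> 1" "0 \<le> y" "y \<le> 1" for x y :: real
    proof (cases "x = 0 \<or> y = 0")
      case True
      then show ?thesis using that \<sigma>\<tau> by auto
    next
      case False
      with that have pos: "0 < x" "0 < y" by auto
      define u where "u = x powr \<sigma> * y powr \<tau>"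
      have "0 \<le> u" "u \<le> 1"
        using that \<sigma>\<tau> by (auto simp: u_def intro!: mult_le_one powr_le1)
      have "x powr s * y powr t = u powr (s + t)"
        using \<sigma>\<tau> by (metis powr_mult powr_powr u_def)
      also have "\<dots> \<le> u powr 1"
        using \<open>0 \<le> u\<close> \<open>u \<le> 1\<close> st by (intro powr_mono') auto
      also have "\<dots> = u" using \<open>0 \<le> u\<close> by simp
      also have "\<dots> \<le> \<sigma> * x + \<tau> * y"
        unfolding u_def using \<sigma>\<tau> pos by (intro Youngs_inequality_0) auto
      finally show ?thesis .
    qed
    have "(\<Sum>i\<in>I. a i powr s * b i powr t)
        = A powr s * B powr t * (\<Sum>i\<in>I. (a i / A) powr s * (b i / B) powr t)"
      unfolding sum_distrib_left using a b 3
      by (intro sum.cong) (auto simp: powr_divide)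
    also have "\<dots> \<le> A powr s * B powr t * (\<Sum>i\<in>I. \<sigma> * (a i / A) + \<tau> * (b i / B))"
    proof (intro mult_left_mono sum_mono le1)
      fix i assume "i \<in> I"
      then have "a i \<le> A" "b i \<le> B"
        unfolding A_def B_def using assms(1) a b by (auto intro!: member_le_sum)
      then show "0 \<le> a i / A" "a i / A \<le> 1" "0 \<le> b i / B" "b i / B \<le> 1"
        using 3 a b \<open>i \<in> I\<close> by auto
    qed auto
    also have "(\<Sum>i\<in>I. \<sigma> * (a i / A) + \<tau> * (b i / B)) = \<sigma> * (A / A) + \<tau> * (B / B)"
      by (simp only: A_def B_def sum.distrib sum_distrib_left sum_divide_distrib)
    also have "\<dots> = 1" using 3 \<sigma>\<tau> by simp
    finally show ?thesis by simp
  qed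
  then show ?thesis by (simp add: A_def B_def)
qed

lemma ex_sequence_with_multiplicities:
  fixes z :: "nat \<Rightarrow> 'z" and n :: "nat \<Rightarrow> nat"
  assumes "z \<in> {1..m} \<rightarrow> Z"
  obtains z' where "z' \<in> {1..\<Sum>j=1..m. n j} \<rightarrow> Z"
    and "\<And>g :: 'z \<Rightarrow> real. (\<Sum>i=1..(\<Sum>j=1..m. n j). g (z' i)) = (\<Sum>j=1..m. real (n j) * g (z j))"
proof -
  define xs where "xs = concat (map (\<lambda>j. replicate (n j) (z j)) [1..<Suc m])"
  have len: "length xs = (\<Sum>j=1..m. n j)"
    by (simp add: xs_def length_concat comp_def interv_sum_list_conv_sum_set_nat
        atLeastLessThanSuc_atLeastAtMost del: upt_Suc)
  have set: "set xs \<subseteq> Z"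
    using assms by (auto simp: xs_def)
  have sum_xs: "sum_list (map g xs) = (\<Sum>j=1..m. real (n j) * g (z j))" for g :: "'z \<Rightarrow> real"
  proof -
    have "sum_list (map g (concat (map (\<lambda>j. replicate (n j) (z j)) js)))
        = sum_list (map (\<lambda>j. real (n j) * g (z j)) js)" for js
      by (induction js) (auto simp: sum_list_replicate)
    then show ?thesis
      by (simp add: xs_def interv_sum_list_conv_sum_set_nat atLeastLessThanSuc_atLeastAtMost
          del: upt_Suc)
  qed
  show thesis
  proof
    show "(\<lambda>i. xs ! (i - 1)) \<in> {1..\<Sum>j=1..m. n j} \<rightarrow> Z"
      unfolding len[symmetric] by (auto intro!: subsetD[OF set] nth_mem)
    fix g :: "'z \<Rightarrow> real"
    have "(\<Sum>i=1..length xs. g (xs ! (i - 1))) = (\<Sum>i<length xs. g (xs ! i))"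
      by (rule sum.reindex_bij_witness[of _ Suc "\<lambda>i. i - 1"]) auto
    also have "\<dots> = sum_list (map g xs)"
      by (simp add: sum_list_sum_nth atLeast0LessThan)
    finally show "(\<Sum>i=1..(\<Sum>j=1..m. n j). g (xs ! (i - 1))) = (\<Sum>j=1..m. real (n j) * g (z j))"
      by (simp add: len sum_xs)
  qed
qed

text \<open>
  Repeating \<open>z\<^sub>j\<close> about \<open>N * \<lambda>\<^sub>j\<close> times and dividing by \<open>N\<close> realises the weight \<open>\<lambda>\<^sub>j\<close> up to \<open>1 / N\<close>.
  The bound \<open>K\<close> on the unweighted sums is what makes this error vanish uniformly in \<open>w\<close> as \<open>N\<close>
  grows.
\<close>

lemma weights_from_repetition:
  fixes g :: "'z \<Rightarrow> real" and h :: "'z \<Rightarrow> 'w \<Rightarrow> real" and lam :: "nat \<Rightarrow> real"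
  assumes repeated: "\<And>m z B. 1 \<le> m \<Longrightarrow> z \<in> {1..m::nat} \<rightarrow> Z \<Longrightarrow>
        (\<And>w. w \<in> W \<Longrightarrow> (\<Sum>j=1..m. h (z j) w) \<le> B) \<Longrightarrow> (\<Sum>j=1..m. g (z j)) \<le> C * B"
    and g: "\<And>x. x \<in> Z \<Longrightarrow> 0 \<le> g x" and h: "\<And>x w. x \<in> Z \<Longrightarrow> w \<in> W \<Longrightarrow> 0 \<le> h x w"
    and m: "1 \<le> m" and z: "z \<in> {1..m} \<rightarrow> Z"
    and lam: "\<And>j. j \<in> {1..m} \<Longrightarrow> 0 \<le> lam j"
    and K: "\<And>w. w \<in> W \<Longrightarrow> (\<Sum>j=1..m. h (z j) w) \<le> K"
    and B: "\<And>w. w \<in> W \<Longrightarrow> (\<Sum>j=1..m. lam j * h (z j) w) \<le> B"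
  shows "(\<Sum>j=1..m. lam j * g (z j)) \<le> C * B"
proof -
  have gz: "0 \<le> g (z j)" and hz: "w \<in> W \<Longrightarrow> 0 \<le> h (z j) w" if "j \<in> {1..m}" for j w
    using funcset_mem[OF z that] g h by auto
  have approx: "(\<Sum>j=1..m. lam j * g (z j)) \<le> C * (B + K * inverse (real (Suc N)))" for N
  proof -
    let ?N = "real (Suc N)"
    \<comment> \<open>The added 1 makes all multiplicities positive, so that the new sequence is nonempty.\<close>
    define n where "n j = Suc (nat \<lfloor>?N * lam j\<rfloor>)" for j
    have n: "?N * lam j \<le> real (n j)" "real (n j) \<le> ?N * lam j + 1" if "j \<in> {1..m}" for j
    proof -
      have "0 \<le> ?N * lam j" using lam[OF that] by simp
      then have "real (n j) = 1 + of_int \<lfloor>?N * lam j\<rfloor>"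
        unfolding n_def by simp
      then show "?N * lam j \<le> real (n j)" "real (n j) \<le> ?N * lam j + 1"
        by linarith+
    qed
    obtain z' where z': "z' \<in> {1..\<Sum>j=1..m. n j} \<rightarrow> Z"
      and sums: "\<And>g :: 'z \<Rightarrow> real.
        (\<Sum>i=1..(\<Sum>j=1..m. n j). g (z' i)) = (\<Sum>j=1..m. real (n j) * g (z j))"
      using ex_sequence_with_multiplicities[OF z] by metis
    have "1 \<le> n 1" by (simp add: n_def)
    also have "n 1 \<le> (\<Sum>j=1..m. n j)" using m by (intro member_le_sum) auto
    finally have len: "1 \<le> (\<Sum>j=1..m. n j)" .
    have h_le: "(\<Sum>i=1..(\<Sum>j=1..m. n j). h (z' i) w) \<le> ?N * B + K" if "w \<in> W" for w
    proof -
      have "(\<Sum>i=1..(\<Sum>j=1..m. n j). h (z' i) w) = (\<Sum>j=1..m. real (n j) * h (z j) w)"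
        by (rule sums)
      also have "\<dots> \<le> (\<Sum>j=1..m. (?N * lam j + 1) * h (z j) w)"
        using n hz that by (intro sum_mono mult_right_mono) auto
      also have "\<dots> = ?N * (\<Sum>j=1..m. lam j * h (z j) w) + (\<Sum>j=1..m. h (z j) w)"
        by (simp only: distrib_right sum.distrib sum_distrib_left mult.assoc mult_1)
      also have "\<dots> \<le> ?N * B + K"
        by (intro add_mono mult_left_mono B K that) auto
      finally show ?thesis .
    qed
    have "?N * (\<Sum>j=1..m. lam j * g (z j)) = (\<Sum>j=1..m. (?N * lam j) * g (z j))"
      by (simp only: sum_distrib_left mult.assoc)
    also have "\<dots> \<le> (\<Sum>j=1..m. real (n j) * g (z j))"
      using n gz by (intro sum_mono mult_right_mono) auto
    also have "\<dots> \<le> C * (?N * B + K)"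
      unfolding sums[symmetric] using len z' h_le by (rule repeated)
    also have "\<dots> = ?N * (C * (B + K * inverse ?N))"
      by (simp add: field_simps)
    finally show ?thesis
      by (rule mult_left_le_imp_le) simp
  qed
  have "(\<lambda>N. C * (B + K * inverse (real (Suc N)))) \<longlonglongrightarrow> C * (B + K * 0)"
    by (intro tendsto_intros LIMSEQ_inverse_real_of_nat)
  then show ?thesis
    using approx by (intro LIMSEQ_le_const[of _ "C * B"]) auto
qed

lemma exponent_ratio_le:
  fixes p1 p2 q1 q2 :: real
  assumes "0 < p1" "p1 \<le> q1" "p1 \<le> p2" "0 < q2"
    and "1 / p1 - 1 / q1 \<le> 1 / p2 - 1 / q2"
  shows "q1 / q2 \<le> p1 / p2"
proof -
  have pos: "0 < q1" "0 < p2" using assms by linarith+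
  \<comment> \<open>Multiply \<open>1 / p1 - 1 / p2 \<le> 1 / q1 - 1 / q2\<close> by \<open>p1\<close> on the left and by \<open>q1 \<ge> p1\<close> on the right.\<close>
  have "0 \<le> 1 / p1 - 1 / p2" using assms pos by (simp add: field_simps)
  then have "p1 * (1 / p1 - 1 / p2) \<le> q1 * (1 / q1 - 1 / q2)"
    using assms pos by (intro mult_mono) auto
  then show ?thesis using assms pos by (simp add: right_diff_distrib)
qed

theorem theorem2p1:
  fixes X :: "'x set" and Y :: "'y set" and Z :: "'z set" and V :: "'v set" and W :: "'w set"
    and H :: "('x \<Rightarrow> 'y) set"
    and R :: "'z \<Rightarrow> 'w \<Rightarrow> real" and S :: "('x \<Rightarrow> 'y) \<Rightarrow> 'z \<Rightarrow> 'v \<Rightarrow> real"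
    and p1 p2 q1 q2 \<alpha> :: real
  assumes "X \<noteq> {}" and "Y \<noteq> {}" and "Z \<noteq> {}" and "V \<noteq> {}" and "W \<noteq> {}"
    and "H \<subseteq> X \<rightarrow>\<^sub>E Y"
    and "\<forall>z\<in>Z. \<forall>w\<in>W. 0 \<le> R z w"
    and "\<forall>f\<in>H. \<forall>z\<in>Z. \<forall>v\<in>V. 0 \<le> S f z v"
    and "p1 \<le> q1" and "p2 \<le> q2"
    and "1 \<le> p1" and "p1 \<le> p2" and "1 \<le> q1" and "q1 \<le> q2"
    and "1 / p1 - 1 / q1 \<le> 1 / p2 - 1 / q2"
    and "finite_sup_sums Z W R p1" and "finite_sup_sums Z W R p2"
    and "\<forall>f\<in>H. finite_sup_sums Z V (S f) q1" and "\<forall>f\<in>H. finite_sup_sums Z V (S f) q2"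
    and "p1 < p2"
    and "\<alpha> = (q2 * p1) / (q1 * p2)"
  shows "RS_summing H Z V W R S q1 1 p1 \<subseteq> RS_summing H Z V W R S q2 \<alpha> p2"
proof
  fix f assume "f \<in> RS_summing H Z V W R S q1 1 p1"
  then obtain C where fH: "f \<in> H" and C: "0 < C"
    and summing: "\<And>m z. 1 \<le> m \<Longrightarrow> z \<in> {1..m::nat} \<rightarrow> Z \<Longrightarrow>
        (SUP v\<in>V. \<Sum>j=1..m. S f (z j) v powr q1) powr (1 / 1)
          \<le> C * (SUP w\<in>W. \<Sum>j=1..m. R (z j) w powr p1)"
    unfolding RS_summing_def by blast
  have pos: "0 < p1" "0 < p2" "0 < q1" "0 < q2" using assms by linarith+
  have ratio: "q1 / q2 \<le> p1 / p2"
    using assms pos by (intro exponent_ratio_le) auto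
  also have "p1 / p2 < 1" using \<open>p1 < p2\<close> pos by simp
  finally have "q1 < q2" using pos by simp
  define C' where "C' = C powr (p2 / p1)"
  have "0 < \<alpha>" and inv_\<alpha>: "1 / \<alpha> = (q1 / q2) * (p2 / p1)"
    using pos by (auto simp: assms(21))
  have "0 < C'" using C by (simp add: C'_def)
  have "(SUP v\<in>V. \<Sum>j=1..m. S f (z j) v powr q2) powr (1 / \<alpha>)
      \<le> C' * (SUP w\<in>W. \<Sum>j=1..m. R (z j) w powr p2)"
    if m: "1 \<le> m" and z: "z \<in> {1..m::nat} \<rightarrow> Z" for m z
  proof -
    define M where "M = (SUP w\<in>W. \<Sum>j=1..m. R (z j) w powr p2)"
    have le_M: "(\<Sum>j=1..m. R (z j) w powr p2) \<le> M" if "w \<in> W" for w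
      unfolding M_def using \<open>finite_sup_sums Z W R p2\<close> m z that
      by (intro cSUP_upper) (auto simp: finite_sup_sums_def)
    obtain w0 where "w0 \<in> W" using \<open>W \<noteq> {}\<close> by auto
    have "0 \<le> (\<Sum>j=1..m. R (z j) w0 powr p2)" by (simp add: sum_nonneg)
    also have "\<dots> \<le> M" by (rule le_M) fact
    finally have "0 \<le> M" .
    have pointwise: "(\<Sum>j=1..m. S f (z j) v powr q2) powr (1 / \<alpha>) \<le> C' * M" if v: "v \<in> V" for v
    proof -
      define T where "T = (\<Sum>j=1..m. S f (z j) v powr q2)"
      define s where "s = (q2 - q1) / q2"
      have "0 \<le> T" by (simp add: T_def sum_nonneg)
      have s: "0 < s" "1 \<le> s + p1 / p2" "1 - s = q1 / q2"
        using \<open>q1 < q2\<close> pos ratio by (auto simp: s_def diff_divide_distrib)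
      have "T = (\<Sum>j=1..m. S f (z j) v powr (q2 - q1) * S f (z j) v powr q1)"
        unfolding T_def by (simp flip: powr_add)
      also have "\<dots> \<le> C * (T powr s * M powr (p1 / p2))"
      proof -
        obtain K where K: "\<And>w. w \<in> W \<Longrightarrow> (\<Sum>j=1..m. R (z j) w powr p1) \<le> K"
          using \<open>finite_sup_sums Z W R p1\<close> m z unfolding finite_sup_sums_def bdd_above_def by fast
        have weighted: "(\<Sum>j=1..m. S f (z j) v powr (q2 - q1) * R (z j) w powr p1)
            \<le> T powr s * M powr (p1 / p2)" if "w \<in> W" for w
        proof -
          have "(\<Sum>j=1..m. S f (z j) v powr (q2 - q1) * R (z j) w powr p1)
              = (\<Sum>j=1..m. (S f (z j) v powr q2) powr s * (R (z j) w powr p2) powr (p1 / p2))"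
            using pos by (simp add: powr_powr s_def)
          also have "\<dots> \<le> T powr s * (\<Sum>j=1..m. R (z j) w powr p2) powr (p1 / p2)"
            unfolding T_def using s pos by (intro Hoelder_sum_powr) auto
          also have "\<dots> \<le> T powr s * M powr (p1 / p2)"
            using le_M[OF that] pos by (intro mult_left_mono powr_mono2) (auto intro: sum_nonneg)
          finally show ?thesis .
        qed
        have repeated: "(\<Sum>j=1..k. S f (x j) v powr q1) \<le> C * B"
          if k: "1 \<le> k" and x: "x \<in> {1..k::nat} \<rightarrow> Z"
            and B: "\<And>w. w \<in> W \<Longrightarrow> (\<Sum>j=1..k. R (x j) w powr p1) \<le> B" for k x B
        proof -
          let ?Q = "SUP v\<in>V. \<Sum>j=1..k. S f (x j) v powr q1"
          have le_Q: "(\<Sum>j=1..k. S f (x j) v powr q1) \<le> ?Q"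
            using assms(18) fH v k x by (intro cSUP_upper) (auto simp: finite_sup_sums_def)
          moreover have "0 \<le> (\<Sum>j=1..k. S f (x j) v powr q1)" by (simp add: sum_nonneg)
          ultimately have "?Q = ?Q powr (1 / 1)" by simp
          also have "\<dots> \<le> C * (SUP w\<in>W. \<Sum>j=1..k. R (x j) w powr p1)"
            using k x by (rule summing)
          also have "\<dots> \<le> C * B"
            using C B \<open>W \<noteq> {}\<close> by (intro mult_left_mono cSUP_least) auto
          finally show ?thesis using le_Q by linarith
        qed
        show ?thesis
        proof (rule weights_from_repetition[where Z = Z and W = W and g = "\<lambda>x. S f x v powr q1"
              and h = "\<lambda>x w. R x w powr p1"])
          show "(\<Sum>j=1..k. S f (x j) v powr q1) \<le> C * B"
            if "1 \<le> k" "x \<in> {1..k::nat} \<rightarrow> Z"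
              "\<And>w. w \<in> W \<Longrightarrow> (\<Sum>j=1..k. R (x j) w powr p1) \<le> B" for k x B
            using that by (rule repeated)
        qed (rule m z K powr_ge_zero weighted; assumption)+
      qed
      finally have T_le: "T \<le> T powr s * (C * M powr (p1 / p2))" by (simp add: mult_ac)
      have "T powr (q1 / q2) \<le> C * M powr (p1 / p2)"
      proof (cases "T = 0")
        case True
        then show ?thesis using C by simp
      next
        case False
        with \<open>0 \<le> T\<close> have "0 < T" by simp
        then have "T powr s * T powr (q1 / q2) = T"
          by (simp flip: powr_add s(3))
        with T_le have "T powr s * T powr (q1 / q2) \<le> T powr s * (C * M powr (p1 / p2))" by simp
        then show ?thesis using \<open>0 < T\<close> by simp
      qed
      then have "(T powr (q1 / q2)) powr (p2 / p1) \<le> (C * M powr (p1 / p2)) powr (p2 / p1)"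
        using pos by (intro powr_mono2) auto
      then show ?thesis
        using C \<open>0 \<le> M\<close> pos by (simp add: powr_powr powr_mult inv_\<alpha> C'_def T_def)
    qed
    \<comment> \<open>The power of a supremum is bounded by inverting the power on each term, as \<open>\<alpha> > 0\<close>.\<close>
    let ?Q = "SUP v\<in>V. \<Sum>j=1..m. S f (z j) v powr q2"
    have le_\<alpha>: "(\<Sum>j=1..m. S f (z j) v powr q2) \<le> (C' * M) powr \<alpha>" if "v \<in> V" for v
    proof -
      have "((\<Sum>j=1..m. S f (z j) v powr q2) powr (1 / \<alpha>)) powr \<alpha> \<le> (C' * M) powr \<alpha>"
        using pointwise[OF that] \<open>0 < \<alpha>\<close> by (intro powr_mono2) auto
      then show ?thesis using \<open>0 < \<alpha>\<close> by (simp add: powr_powr sum_nonneg)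
    qed
    have "?Q \<le> (C' * M) powr \<alpha>"
      using \<open>V \<noteq> {}\<close> le_\<alpha> by (rule cSUP_least)
    moreover have "0 \<le> ?Q"
    proof -
      obtain v0 where "v0 \<in> V" using \<open>V \<noteq> {}\<close> by auto
      have "0 \<le> (\<Sum>j=1..m. S f (z j) v0 powr q2)" by (simp add: sum_nonneg)
      also have "\<dots> \<le> ?Q"
        using \<open>v0 \<in> V\<close> le_\<alpha> by (intro cSUP_upper bdd_aboveI2) auto
      finally show ?thesis .
    qed
    ultimately have "?Q powr (1 / \<alpha>) \<le> ((C' * M) powr \<alpha>) powr (1 / \<alpha>)"
      using \<open>0 < \<alpha>\<close> by (intro powr_mono2) auto
    also have "\<dots> = C' * M"
      using \<open>0 < \<alpha>\<close> \<open>0 < C'\<close> \<open>0 \<le> M\<close> by (simp add: powr_powr)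
    finally show ?thesis by (simp add: M_def)
  qed
  then show "f \<in> RS_summing H Z V W R S q2 \<alpha> p2"
    unfolding RS_summing_def using fH \<open>0 < C'\<close> by blast
qed

end
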